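(* Let $\phi,\psi,\chi$ be geometric formulae, $S$ a set of geometric formulae, and $x,y,x_i,y_i$ variables. Graded sequents satisfy: 1. $gr(\phi\vdash\phi)=1$; 2. $gr(\phi\vdash\psi)\wedge gr(\psi\vdash\chi)\le gr(\phi\vdash\chi)$; 3. (i) $gr(\phi\vdash\top)=1$; (ii) $gr(\phi\wedge\psi\vdash\phi)=1$; (iii) $gr(\phi\wedge\psi\vdash\psi)=1$; (iv) $gr(\phi\vdash\psi)\wedge gr(\phi\vdash\chi)=gr(\phi\vdash\psi\wedge\chi)$; 4. (i) $gr(\phi\vdash\bigvee S)=1$ if $\phi\in S$; (ii) $\inf_{\phi\in S}\{gr(\phi\vdash\psi)\}\le gr(\bigvee S\vdash\psi)$; 5. $gr(\phi\wedge\bigvee S\vdash\bigvee\{\phi\wedge\psi\mid\psi\in S\})=1$; 6. $gr(\top\vdash(x=x))=1$; 7. $gr(((x_1,\dots,x_n)=(y_1,\dots,y_n))\wedge\phi\vdash\phi[(y_1,\dots,y_n)/(x_1,\dots,x_n)])=1$; 8. (i) $gr(\phi\vdash\psi[x/y])\le gr(\phi\vdash\exists y\psi)$; (ii) $gr(\exists y\phi\vdash\psi)\le gr(\phi[x/y]\vdash\psi)$; 9. $gr(\phi\wedge(\exists y)\psi\vdash(\exists y)(\phi\wedge\psi))=1$.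
   Context: Language: countably many individual constants $c_i$, denumerably many variables $x_1,x_2,\dots$, propositional constants $\top,\bot$, for each $i>0$ countably many $i$-place predicate symbols $p^i_j$ (including 2-place identity "$=$") and countably many $i$-place function symbols $f^i_j$. Terms are built from constants and variables by function symbols. Geometric formulae: $\top$, $\bot$, $p^i_jt_1\dots t_i$, $(t_i=t_j)$ for terms; $(\phi\wedge\psi)$; $\bigvee\{\phi_i\}_{i\in I}$ for any family of geometric formulae (for a two-element index set written $\phi_1\vee\phi_2$); $\exists x_i\phi$; nothing else. $(x_1,\dots,x_n)=(y_1,\dots,y_n)$ means the conjunction of the equations $x_i=y_i$. $\phi[t/x]$ is the result of replacing every free occurrence of $x$ in $\phi$ by the term $t$ (simultaneously for tuples), defined recursively: it replaces $x$ by $t$ in the terms of atomic formulae, commutes with $\wedge$ and $\bigvee$, fixes $\top$ and $\bot$, $(\exists x_i\psi)[t/x]=\exists x_i(\psi[t/x])$ if $x_i$ is other than $x$, and $(\exists x\psi)[t/x]=\exists x\psi$. Fix an interpretation $I$: a set $D$, elements $I(c_i)\in D$, functions $I(f^i_j):D^i\to D$ and fuzzy relations $I(p^i_j):D^i\to[0,1]$. For a sequence $s=(s_1,s_2,\dots)$ over $D$ and $d\in D$, $s(d/x_i)$ is $s$ with its $i$-th coordinate replaced by $d$; $s(c_i)=I(c_i)$, $s(x_i)=s_i$, $s(f^i_jt_1\dots t_i)=I(f^i_j)(s(t_1),\dots,s(t_i))$. The grade $gr(s\ \text{sat}\ \phi)\in[0,1]$ is: $gr(s\ \text{sat}\ p^i_jt_1\dots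 t_i)=I(p^i_j)(s(t_1),\dots,s(t_i))$; $gr(s\ \text{sat}\ \top)=1$; $gr(s\ \text{sat}\ \bot)=0$; $gr(s\ \text{sat}\ t_i=t_j)=1$ if $s(t_i)=s(t_j)$ and $0$ otherwise; $gr(s\ \text{sat}\ \phi_1\wedge\phi_2)=\min$ of the two grades; $gr(s\ \text{sat}\ \bigvee\{\phi_i\}_{i\in I})=\sup_{i}gr(s\ \text{sat}\ \phi_i)$; $gr(s\ \text{sat}\ \exists x_i\phi)=\sup_{d\in D}gr(s(d/x_i)\ \text{sat}\ \phi)$. The Gödel arrow on $[0,1]$: $a\to b=1$ if $a\le b$, and $a\to b=b$ if $a>b$. The grade of a sequent is $gr(s\ \text{sat}\ \phi\vdash\psi)=gr(s\ \text{sat}\ \phi)\to gr(s\ \text{sat}\ \psi)$ and $gr(\phi\vdash\psi)=\inf_s\{gr(s\ \text{sat}\ \phi\vdash\psi)\}$, over all sequences $s$ over $D$. In $[0,1]$, $\wedge$ is minimum.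
   Formalization: Items 7 and 8 are stated only when the substitution captures no variable (the substituted variables are free for the replaced ones), and item 9 only when y is not free in φ; with the non-renaming substitution given, the unrestricted items are false. *)

theory Defs
  imports Complex_Main
begin

text \<open>
  The \<open>i\<close>-place symbols \<open>f\<^sup>i\<^sub>j\<close> and \<open>p\<^sup>i\<^sub>j\<close> (with \<open>i > 0\<close>) are represented by the index \<open>j\<close> alone,
  applied to a first argument and a list of \<open>i - 1\<close> further arguments; the arity is read off
  from the number of arguments.  Identity is not among the \<open>Pred\<close> symbols: equations have
  their own constructor, as they have their own clause in the semantics.
\<close>

datatype tm =
    Var nat
  | Const nat
  | Fun nat tm "tm list"

text \<open>
  \<open>Disj J F\<close> is the disjunction of the family \<open>F i\<close>, \<open>i \<in> J\<close>.  There is no type of formulae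
  that is closed under disjunctions of all of its own subsets, so the type of formulae depends on a
  type \<open>'i\<close> from which all index sets are drawn.  Nothing is assumed about \<open>'i\<close>; statements
  polymorphic in \<open>'i\<close> cover families of any size.
\<close>

datatype (dead 'i) fm =
    Truth
  | Falsity
  | Pred nat tm "tm list"
  | Eq tm tm
  | And "'i fm" "'i fm"
  | Disj "'i set" "'i \<Rightarrow> 'i fm"
  | Exists nat "'i fm"

text \<open>The empty conjunction is only needed for tuples of length 0.\<close>

fun conj_list :: "'i fm list \<Rightarrow> 'i fm" where
  "conj_list [] = Truth"
| "conj_list [\<phi>] = \<phi>"
| "conj_list (\<phi> # \<psi> # \<phi>s) = And \<phi> (conj_list (\<psi> # \<phi>s))"

definition tuple_eq :: "nat list \<Rightarrow> nat list \<Rightarrow> 'i fm" where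
  "tuple_eq xs ys = conj_list (map2 (\<lambda>x y. Eq (Var x) (Var y)) xs ys)"


primrec tm_vars :: "tm \<Rightarrow> nat set" where
  "tm_vars (Var x) = {x}"
| "tm_vars (Const c) = {}"
| "tm_vars (Fun j t ts) = tm_vars t \<union> \<Union> (set (map tm_vars ts))"

primrec free_vars :: "'i fm \<Rightarrow> nat set" where
  "free_vars Truth = {}"
| "free_vars Falsity = {}"
| "free_vars (Pred j t ts) = tm_vars t \<union> \<Union> (set (map tm_vars ts))"
| "free_vars (Eq t u) = tm_vars t \<union> tm_vars u"
| "free_vars (And \<phi> \<psi>) = free_vars \<phi> \<union> free_vars \<psi>"
| "free_vars (Disj J F) = (\<Union>i\<in>J. free_vars (F i))"
| "free_vars (Exists x \<phi>) = free_vars \<phi> - {x}"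

text \<open>
  Simultaneous substitution along a finite map \<open>m\<close> from variables to terms, where variables
  outside the domain of \<open>m\<close> are left alone.  A quantifier removes its variable from \<open>m\<close>, which
  gives the two usual clauses for a single variable proved below.  Bound variables are not renamed,
  so capture is possible; \<open>free_for m \<phi>\<close> says that none occurs.  Substitution and equality
  laws fail without this condition, e.g. for \<open>\<exists>y. p(x,y)\<close> with \<open>y\<close> substituted for \<open>x\<close>.
\<close>

primrec tm_subst :: "(nat \<rightharpoonup> tm) \<Rightarrow> tm \<Rightarrow> tm" where
  "tm_subst m (Var x) = (case m x of None \<Rightarrow> Var x | Some t \<Rightarrow> t)"
| "tm_subst m (Const c) = Const c"
| "tm_subst m (Fun j t ts) = Fun j (tm_subst m t) (map (tm_subst m) ts)"

primrec subst :: "(nat \<rightharpoonup> tm) \<Rightarrow> 'i fm \<Rightarrow> 'i fm" where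
  "subst m Truth = Truth"
| "subst m Falsity = Falsity"
| "subst m (Pred j t ts) = Pred j (tm_subst m t) (map (tm_subst m) ts)"
| "subst m (Eq t u) = Eq (tm_subst m t) (tm_subst m u)"
| "subst m (And \<phi> \<psi>) = And (subst m \<phi>) (subst m \<psi>)"
| "subst m (Disj J F) = Disj J (\<lambda>i. subst m (F i))"
| "subst m (Exists x \<phi>) = Exists x (subst (m(x := None)) \<phi>)"

primrec free_for :: "(nat \<rightharpoonup> tm) \<Rightarrow> 'i fm \<Rightarrow> bool" where
  "free_for m Truth = True"
| "free_for m Falsity = True"
| "free_for m (Pred j t ts) = True"
| "free_for m (Eq t u) = True"
| "free_for m (And \<phi> \<psi>) = (free_for m \<phi> \<and> free_for m \<psi>)"
| "free_for m (Disj J F) = (\<forall>i\<in>J. free_for m (F i))"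
| "free_for m (Exists x \<phi>) =
     ((\<forall>y \<in> free_vars \<phi> - {x}. \<forall>t. m y = Some t \<longrightarrow> x \<notin> tm_vars t)
      \<and> free_for (m(x := None)) \<phi>)"

lemma tm_subst_empty: "tm_subst Map.empty t = t"
  by (induction t) (auto intro: map_idI)

lemma subst_empty: "subst Map.empty \<phi> = \<phi>"
proof (induction \<phi>)
  case (Exists x \<phi>)
  then show ?case by (simp add: fun_upd_idem)
qed (auto simp: tm_subst_empty intro: map_idI)

lemma subst_Exists_same: "subst [x \<mapsto> t] (Exists x \<psi>) = Exists x \<psi>"
  by (simp add: subst_empty)

lemma subst_Exists_other: "z \<noteq> x \<Longrightarrow> subst [x \<mapsto> t] (Exists z \<psi>) = Exists z (subst [x \<mapsto> t] \<psi>)"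
proof -
  assume "z \<noteq> x"
  then have "[x \<mapsto> t](z := None) = [x \<mapsto> t]" by (simp add: fun_eq_iff)
  then show ?thesis by simp
qed


text \<open>
  On argument lists of length \<open>i\<close>, \<open>fun_of I j\<close> and \<open>pred_of I j\<close> are the interpretations of
  \<open>f\<^sup>i\<^sub>j\<close> and \<open>p\<^sup>i\<^sub>j\<close>.  Their values on the empty list or outside the domain are irrelevant.
\<close>

record 'd interp =
  dom_of :: "'d set"
  const_of :: "nat \<Rightarrow> 'd"
  fun_of :: "nat \<Rightarrow> 'd list \<Rightarrow> 'd"
  pred_of :: "nat \<Rightarrow> 'd list \<Rightarrow> real"

definition is_interp :: "'d interp \<Rightarrow> bool" where
  "is_interp I \<longleftrightarrow>
     (\<forall>c. const_of I c \<in> dom_of I)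
   \<and> (\<forall>j ds. ds \<noteq> [] \<and> set ds \<subseteq> dom_of I \<longrightarrow> fun_of I j ds \<in> dom_of I)
   \<and> (\<forall>j ds. ds \<noteq> [] \<and> set ds \<subseteq> dom_of I \<longrightarrow> pred_of I j ds \<in> {0..1})"

definition seqs :: "'d interp \<Rightarrow> (nat \<Rightarrow> 'd) set" where
  "seqs I = {s. \<forall>n. s n \<in> dom_of I}"

text \<open>
  Supremum and infimum in the complete lattice \<open>[0,1]\<close>: for \<open>A \<subseteq> {0..1}\<close>, inserting the
  least (greatest) element changes nothing unless \<open>A\<close> is empty, where it gives 0 (1).
\<close>

definition Sup01 :: "real set \<Rightarrow> real" where
  "Sup01 A = Sup (insert 0 A)"

definition Inf01 :: "real set \<Rightarrow> real" where
  "Inf01 A = Inf (insert 1 A)"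

primrec tm_val :: "'d interp \<Rightarrow> (nat \<Rightarrow> 'd) \<Rightarrow> tm \<Rightarrow> 'd" where
  "tm_val I s (Var x) = s x"
| "tm_val I s (Const c) = const_of I c"
| "tm_val I s (Fun j t ts) = fun_of I j (tm_val I s t # map (tm_val I s) ts)"

primrec gr_sat :: "'d interp \<Rightarrow> (nat \<Rightarrow> 'd) \<Rightarrow> 'i fm \<Rightarrow> real" where
  "gr_sat I s Truth = 1"
| "gr_sat I s Falsity = 0"
| "gr_sat I s (Pred j t ts) = pred_of I j (tm_val I s t # map (tm_val I s) ts)"
| "gr_sat I s (Eq t u) = (if tm_val I s t = tm_val I s u then 1 else 0)"
| "gr_sat I s (And \<phi> \<psi>) = min (gr_sat I s \<phi>) (gr_sat I s \<psi>)"
| "gr_sat I s (Disj J F) = Sup01 ((\<lambda>i. gr_sat I s (F i)) ` J)"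
| "gr_sat I s (Exists x \<phi>) = Sup01 ((\<lambda>d. gr_sat I (s(x := d)) \<phi>) ` dom_of I)"

definition goedel_arrow :: "real \<Rightarrow> real \<Rightarrow> real" where
  "goedel_arrow a b = (if a \<le> b then 1 else b)"

definition gr :: "'d interp \<Rightarrow> 'i fm \<Rightarrow> 'i fm \<Rightarrow> real" where
  "gr I \<phi> \<psi> = Inf01 ((\<lambda>s. goedel_arrow (gr_sat I s \<phi>) (gr_sat I s \<psi>)) ` seqs I)"

end

theory Submission
  imports Defs
begin

text \<open>
  On \<open>[0,1]\<close> the Goedel arrow is right adjoint to the minimum.  Taking the infimum over all
  sequences, this gives a description of graded sequents that mentions neither arrow nor infimum
  (\<open>le_gr_iff\<close>): \<open>c \<le> gr I \<phi> \<psi>\<close> holds iff \<open>c \<le> 1\<close> and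
  \<open>min c (gr_sat I s \<phi>) \<le> gr_sat I s \<psi>\<close> for every \<open>s\<close>.  An inequality between
  grades of sequents thus becomes a pointwise entailment with an extra hypothesis of grade \<open>c\<close>,
  and a sequent has grade 1 iff the grade of its left side never exceeds that of its right side.

  What remains is of two kinds.  The propositional and quantifier laws are lattice laws: since
  \<open>[0,1]\<close> is a frame, meeting with a fixed element commutes with suprema
  (\<open>min_Sup01_le_iff\<close>), which is at once the elimination law for \<open>\<Or>\<close> and the
  distributivity of \<open>\<and>\<close> over \<open>\<Or>\<close> and \<open>\<exists>\<close>.  The laws about substitution follow
  from the substitution lemma (\<open>gr_sat_subst\<close>): the grade of a substituted formula at \<open>s\<close>
  is the grade of the original formula at a modified sequence.  For \<open>[y \<mapsto> Var x]\<close> the modified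
  sequence is \<open>s(y := s x)\<close>, so the grade is one of those whose supremum is the grade of
  \<open>\<exists>y\<close>.  For a tuple substitution it is \<open>s\<close> itself whenever the equations between the
  tuples hold at \<open>s\<close>; otherwise these equations have grade 0.
\<close>

section \<open>Lattice structure of the unit interval\<close>

lemma Sup01_le_iff:
  assumes "A \<subseteq> {0..1}"
  shows "Sup01 A \<le> b \<longleftrightarrow> 0 \<le> b \<and> (\<forall>a\<in>A. a \<le> b)"
proof -
  have "bdd_above (insert 0 A)"
    by (rule bdd_aboveI[of _ 1]) (use assms in auto)
  then show ?thesis
    unfolding Sup01_def by (subst cSup_le_iff) auto
qed

lemma Sup01_upper:
  assumes "A \<subseteq> {0..1}" "a \<in> A"
  shows "a \<le> Sup01 A"
  using Sup01_le_iff[OF assms(1)] assms(2) by blast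

lemma Sup01_in_01:
  assumes "A \<subseteq> {0..1}"
  shows "Sup01 A \<in> {0..1}"
  using Sup01_le_iff[OF assms, of "Sup01 A"] Sup01_le_iff[OF assms, of 1] assms by auto

lemma le_Inf01_iff:
  assumes "A \<subseteq> {0..1}"
  shows "c \<le> Inf01 A \<longleftrightarrow> c \<le> 1 \<and> (\<forall>a\<in>A. c \<le> a)"
proof -
  have "bdd_below (insert 1 A)"
    by (rule bdd_belowI[of _ 0]) (use assms in auto)
  then show ?thesis
    unfolding Inf01_def by (subst le_cInf_iff) auto
qed

text \<open>
  The frame law.  The order is total, so either \<open>c \<le> b\<close>, and both sides hold, or
  \<open>min c a \<le> b\<close> means \<open>a \<le> b\<close>.  The bound \<open>0 \<le> b\<close> accounts for the
  empty set, whose supremum is 0.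
\<close>

lemma min_Sup01_le_iff:
  assumes "A \<subseteq> {0..1}" "0 \<le> b"
  shows "min c (Sup01 A) \<le> b \<longleftrightarrow> (\<forall>a\<in>A. min c a \<le> b)"
  using Sup01_le_iff[OF assms(1), of b] assms(2) by (auto simp: min_le_iff_disj)

lemma le_goedel_arrow_iff:
  assumes "c \<le> 1"
  shows "c \<le> goedel_arrow a b \<longleftrightarrow> min c a \<le> b"
  using assms by (auto simp: goedel_arrow_def min_le_iff_disj)

section \<open>Grades of formulae and of sequents\<close>

lemma seqs_update: "s \<in> seqs I \<Longrightarrow> d \<in> dom_of I \<Longrightarrow> s(x := d) \<in> seqs I"
  by (simp add: seqs_def)

lemma tm_val_in_dom:
  assumes "is_interp I" "s \<in> seqs I"
  shows "tm_val I s t \<in> dom_of I"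
proof (induction t)
  case (Fun j t ts)
  then have "set (tm_val I s t # map (tm_val I s) ts) \<subseteq> dom_of I" by auto
  then show ?case using assms(1) by (simp add: is_interp_def)
qed (use assms in \<open>auto simp: is_interp_def seqs_def\<close>)

lemma gr_sat_in_01:
  assumes "is_interp I" "s \<in> seqs I"
  shows "gr_sat I s \<phi> \<in> {0..1}"
  using assms(2)
proof (induction \<phi> arbitrary: s)
  case (Pred j t ts)
  then have "set (tm_val I s t # map (tm_val I s) ts) \<subseteq> dom_of I"
    using tm_val_in_dom[OF assms(1)] by auto
  then have "pred_of I j (tm_val I s t # map (tm_val I s) ts) \<in> {0..1}"
    using assms(1) unfolding is_interp_def by blast
  then show ?case by simp
next
  case (And \<phi> \<psi>)
  then show ?case by (auto simp: min_def)
next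
  case (Disj J F)
  then have "(\<lambda>i. gr_sat I s (F i)) ` J \<subseteq> {0..1}" by blast
  then show ?case unfolding gr_sat.simps by (rule Sup01_in_01)
next
  case (Exists x \<phi>)
  then have "(\<lambda>d. gr_sat I (s(x := d)) \<phi>) ` dom_of I \<subseteq> {0..1}"
    using Exists.IH[OF seqs_update[OF Exists.prems]] by blast
  then show ?case unfolding gr_sat.simps by (rule Sup01_in_01)
qed auto

lemma Disj_grades_in_01:
  assumes "is_interp I" "s \<in> seqs I"
  shows "(\<lambda>i. gr_sat I s (F i)) ` J \<subseteq> {0..1}"
  using gr_sat_in_01[OF assms] by blast

lemma Exists_grades_in_01:
  assumes "is_interp I" "s \<in> seqs I"
  shows "(\<lambda>d. gr_sat I (s(x := d)) \<phi>) ` dom_of I \<subseteq> {0..1}"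
  using gr_sat_in_01[OF assms(1) seqs_update[OF assms(2)]] by blast

lemma gr_sat_le_Disj:
  assumes "is_interp I" "s \<in> seqs I" "i \<in> J"
  shows "gr_sat I s (F i) \<le> gr_sat I s (Disj J F)"
  unfolding gr_sat.simps
  by (rule Sup01_upper[OF Disj_grades_in_01[OF assms(1,2)]]) (use assms(3) in blast)

lemma gr_sat_le_Exists:
  assumes "is_interp I" "s \<in> seqs I" "d \<in> dom_of I"
  shows "gr_sat I (s(x := d)) \<phi> \<le> gr_sat I s (Exists x \<phi>)"
  unfolding gr_sat.simps
  by (rule Sup01_upper[OF Exists_grades_in_01[OF assms(1,2)]]) (use assms(3) in blast)

lemma min_Disj_le_iff:
  assumes "is_interp I" "s \<in> seqs I" "0 \<le> b"
  shows "min c (gr_sat I s (Disj J F)) \<le> b \<longleftrightarrow> (\<forall>i\<in>J. min c (gr_sat I s (F i)) \<le> b)"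
  using min_Sup01_le_iff[OF Disj_grades_in_01[OF assms(1,2)] assms(3)] by simp

lemma min_Exists_le_iff:
  assumes "is_interp I" "s \<in> seqs I" "0 \<le> b"
  shows "min c (gr_sat I s (Exists x \<phi>)) \<le> b
    \<longleftrightarrow> (\<forall>d\<in>dom_of I. min c (gr_sat I (s(x := d)) \<phi>) \<le> b)"
  using min_Sup01_le_iff[OF Exists_grades_in_01[OF assms(1,2)] assms(3)] by simp

lemma goedel_arrow_grades_in_01:
  assumes "is_interp I"
  shows "(\<lambda>s. goedel_arrow (gr_sat I s \<phi>) (gr_sat I s \<psi>)) ` seqs I \<subseteq> {0..1}"
  using gr_sat_in_01[OF assms, of _ \<psi>] by (auto simp: goedel_arrow_def)

text \<open>
  The adjunction between minimum and arrow, carried from grades at one sequence to grades of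
  sequents.  The bound \<open>c \<le> 1\<close> is needed because \<open>c\<close> ranges over all reals, whereas
  \<open>gr I \<phi> \<psi>\<close> is an infimum in \<open>[0,1]\<close>.
\<close>

lemma le_gr_iff:
  assumes "is_interp I"
  shows "c \<le> gr I \<phi> \<psi>
    \<longleftrightarrow> c \<le> 1 \<and> (\<forall>s\<in>seqs I. min c (gr_sat I s \<phi>) \<le> gr_sat I s \<psi>)"
  unfolding gr_def le_Inf01_iff[OF goedel_arrow_grades_in_01[OF assms]]
  by (auto simp: le_goedel_arrow_iff)

lemma gr_in_01:
  assumes "is_interp I"
  shows "gr I \<phi> \<psi> \<in> {0..1}"
proof -
  have "0 \<le> gr I \<phi> \<psi>"
    using gr_sat_in_01[OF assms, of _ \<psi>] by (auto simp: le_gr_iff[OF assms] min_le_iff_disj)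
  moreover have "gr I \<phi> \<psi> \<le> 1"
    using le_gr_iff[OF assms, of "gr I \<phi> \<psi>" \<phi> \<psi>] by simp
  ultimately show ?thesis by simp
qed

lemma min_gr_le:
  assumes "is_interp I" "s \<in> seqs I"
  shows "min (gr I \<phi> \<psi>) (gr_sat I s \<phi>) \<le> gr_sat I s \<psi>"
  using le_gr_iff[OF assms(1), of "gr I \<phi> \<psi>" \<phi> \<psi>] assms(2) by blast

lemma gr_eq_1_iff:
  assumes "is_interp I"
  shows "gr I \<phi> \<psi> = 1 \<longleftrightarrow> (\<forall>s\<in>seqs I. gr_sat I s \<phi> \<le> gr_sat I s \<psi>)"
proof -
  have "gr I \<phi> \<psi> = 1 \<longleftrightarrow> 1 \<le> gr I \<phi> \<psi>"
    using gr_in_01[OF assms, of \<phi> \<psi>] by auto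
  then show ?thesis
    using gr_sat_in_01[OF assms, of _ \<phi>] by (simp add: le_gr_iff[OF assms] min_absorb2)
qed

lemma gr_mono:
  assumes "is_interp I"
    and "\<And>s. s \<in> seqs I \<Longrightarrow> gr_sat I s \<phi>' \<le> gr_sat I s \<phi>"
    and "\<And>s. s \<in> seqs I \<Longrightarrow> gr_sat I s \<psi> \<le> gr_sat I s \<psi>'"
  shows "gr I \<phi> \<psi> \<le> gr I \<phi>' \<psi>'"
  unfolding le_gr_iff[OF assms(1), of _ \<phi>']
proof (intro conjI ballI)
  show "gr I \<phi> \<psi> \<le> 1" using gr_in_01[OF assms(1), of \<phi> \<psi>] by simp
  fix s assume s: "s \<in> seqs I"
  show "min (gr I \<phi> \<psi>) (gr_sat I s \<phi>') \<le> gr_sat I s \<psi>'"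
    using min_gr_le[OF assms(1) s, of \<phi> \<psi>] assms(2,3)[OF s] by linarith
qed

section \<open>Laws of conjunction and disjunction\<close>

text \<open>Transitivity is the cut rule: the two hypotheses of grade \<open>gr\<close> are used one after the other.\<close>

lemma gr_trans:
  assumes "is_interp I"
  shows "min (gr I \<phi> \<psi>) (gr I \<psi> \<chi>) \<le> gr I \<phi> \<chi>"
  unfolding le_gr_iff[OF assms, of _ \<phi> \<chi>]
proof (intro conjI ballI)
  show "min (gr I \<phi> \<psi>) (gr I \<psi> \<chi>) \<le> 1"
    using gr_in_01[OF assms, of \<phi> \<psi>] by (simp add: min_le_iff_disj)
  fix s assume s: "s \<in> seqs I"
  show "min (min (gr I \<phi> \<psi>) (gr I \<psi> \<chi>)) (gr_sat I s \<phi>) \<le> gr_sat I s \<chi>"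
    using min_gr_le[OF assms s, of \<phi> \<psi>] min_gr_le[OF assms s, of \<psi> \<chi>] by linarith
qed

text \<open>Two reals are equal if they have the same lower bounds.\<close>

lemma gr_And_right:
  assumes "is_interp I"
  shows "gr I \<phi> (And \<psi> \<chi>) = min (gr I \<phi> \<psi>) (gr I \<phi> \<chi>)"
proof -
  have "c \<le> gr I \<phi> (And \<psi> \<chi>) \<longleftrightarrow> c \<le> min (gr I \<phi> \<psi>) (gr I \<phi> \<chi>)" for c
    by (auto simp: le_gr_iff[OF assms])
  then show ?thesis by (meson order.antisym order.refl)
qed

lemma Inf_gr_le_gr_Disj:
  assumes "is_interp I"
  shows "Inf01 ((\<lambda>\<theta>. gr I \<theta> \<psi>) ` F ` J) \<le> gr I (Disj J F) \<psi>" (is "?c \<le> _")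
  unfolding le_gr_iff[OF assms, of _ "Disj J F"]
proof (intro conjI ballI)
  have "(\<lambda>\<theta>. gr I \<theta> \<psi>) ` F ` J \<subseteq> {0..1}"
    using gr_in_01[OF assms] by blast
  from le_Inf01_iff[OF this, of ?c]
  have c: "?c \<le> 1" "\<forall>i\<in>J. ?c \<le> gr I (F i) \<psi>" by auto
  show "?c \<le> 1" by fact
  fix s assume s: "s \<in> seqs I"
  have "min ?c (gr_sat I s (F i)) \<le> gr_sat I s \<psi>" if "i \<in> J" for i
    using c(2) that s le_gr_iff[OF assms] by blast
  then show "min ?c (gr_sat I s (Disj J F)) \<le> gr_sat I s \<psi>"
    using gr_sat_in_01[OF assms s, of \<psi>] by (simp add: min_Disj_le_iff[OF assms s] del: gr_sat.simps(6))
qed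

text \<open>
  The families \<open>F\<close> and \<open>G\<close> may be indexed quite differently, since a supremum depends only on
  the set of its members.
\<close>

lemma gr_And_Disj:
  assumes "is_interp I" and GK: "G ` K = {And \<phi> \<theta> | \<theta>. \<theta> \<in> F ` J}"
  shows "gr I (And \<phi> (Disj J F)) (Disj K G) = 1"
  unfolding gr_eq_1_iff[OF assms(1)]
proof
  fix s assume s: "s \<in> seqs I"
  have "min (gr_sat I s \<phi>) (gr_sat I s (F i)) \<le> gr_sat I s (Disj K G)" if i: "i \<in> J" for i
  proof -
    have "And \<phi> (F i) \<in> G ` K" using i GK by blast
    then obtain k where "k \<in> K" "G k = And \<phi> (F i)" by (metis imageE)
    then show ?thesis using gr_sat_le_Disj[OF assms(1) s, of k K G] by simp
  qed
  moreover have "0 \<le> gr_sat I s (Disj K G)"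
    using gr_sat_in_01[OF assms(1) s, of "Disj K G"] by simp
  ultimately show "gr_sat I s (And \<phi> (Disj J F)) \<le> gr_sat I s (Disj K G)"
    by (simp add: min_Disj_le_iff[OF assms(1) s] del: gr_sat.simps(6))
qed

section \<open>Substitution and quantifiers\<close>

lemma tm_val_cong:
  "(\<And>z. z \<in> tm_vars t \<Longrightarrow> s z = s' z) \<Longrightarrow> tm_val I s t = tm_val I s' t"
proof (induction t)
  case (Fun j t ts)
  have "map (tm_val I s) ts = map (tm_val I s') ts"
    using Fun by (intro map_cong) auto
  then show ?case using Fun by (simp del: map_eq_conv)
qed auto

lemma gr_sat_cong:
  "(\<And>z. z \<in> free_vars \<phi> \<Longrightarrow> s z = s' z) \<Longrightarrow> gr_sat I s \<phi> = gr_sat I s' \<phi>"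
proof (induction \<phi> arbitrary: s s')
  case (Pred j t ts)
  have "map (tm_val I s) ts = map (tm_val I s') ts"
    using Pred by (intro map_cong tm_val_cong) auto
  moreover have "tm_val I s t = tm_val I s' t"
    using Pred by (intro tm_val_cong) auto
  ultimately show ?case by (simp del: map_eq_conv)
next
  case (Eq t u)
  have "tm_val I s t = tm_val I s' t" "tm_val I s u = tm_val I s' u"
    using Eq by (auto intro!: tm_val_cong)
  then show ?case by simp
next
  case (And \<phi> \<psi>)
  have "gr_sat I s \<phi> = gr_sat I s' \<phi>"
    by (rule And.IH(1), rule And.prems) simp
  moreover have "gr_sat I s \<psi> = gr_sat I s' \<psi>"
    by (rule And.IH(2), rule And.prems) simp
  ultimately show ?case by simp
next
  case (Disj J F)
  have "gr_sat I s (F i) = gr_sat I s' (F i)" if "i \<in> J" for i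
    by (rule Disj.IH) (use Disj.prems that in auto)
  then show ?case by (simp cong: image_cong)
next
  case (Exists x \<phi>)
  have "gr_sat I (s(x := d)) \<phi> = gr_sat I (s'(x := d)) \<phi>" for d
    by (rule Exists.IH) (use Exists.prems in auto)
  then show ?case by simp
qed auto

text \<open>The semantic counterpart of substitution, through which both substitution lemmas are stated.\<close>

definition subst_seq :: "'d interp \<Rightarrow> (nat \<rightharpoonup> tm) \<Rightarrow> (nat \<Rightarrow> 'd) \<Rightarrow> nat \<Rightarrow> 'd" where
  "subst_seq I m s z = tm_val I s (tm_subst m (Var z))"

lemma tm_val_subst: "tm_val I s (tm_subst m t) = tm_val I (subst_seq I m s) t"
proof (induction t)
  case (Fun j t ts)
  have "map (tm_val I s \<circ> tm_subst m) ts = map (tm_val I (subst_seq I m s)) ts"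
    using Fun by (intro map_cong) auto
  then show ?case using Fun by (simp del: map_eq_conv)
qed (auto simp: subst_seq_def)

text \<open>
  The quantifier case is where \<open>free_for\<close> enters: a substituted term does not mention the bound
  variable, so evaluating it is insensitive to the value \<open>d\<close> which the quantifier assigns.
\<close>

lemma gr_sat_subst:
  "free_for m \<phi> \<Longrightarrow> gr_sat I s (subst m \<phi>) = gr_sat I (subst_seq I m s) \<phi>"
proof (induction \<phi> arbitrary: m s)
  case (Pred j t ts)
  have "map (tm_val I s \<circ> tm_subst m) ts = map (tm_val I (subst_seq I m s)) ts"
    by (simp add: tm_val_subst)
  then show ?case by (simp add: tm_val_subst del: map_eq_conv)
next
  case (Eq t u)
  then show ?case by (simp add: tm_val_subst)
next
  case (Disj J F)
  have "gr_sat I s (subst m (F i)) = gr_sat I (subst_seq I m s) (F i)" if "i \<in> J" for i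
    by (rule Disj.IH) (use Disj.prems that in auto)
  then show ?case by (simp cong: image_cong)
next
  case (Exists x \<phi>)
  have "gr_sat I (s(x := d)) (subst (m(x := None)) \<phi>) = gr_sat I ((subst_seq I m s)(x := d)) \<phi>"
    for d
  proof -
    have "gr_sat I (s(x := d)) (subst (m(x := None)) \<phi>)
        = gr_sat I (subst_seq I (m(x := None)) (s(x := d))) \<phi>"
      by (rule Exists.IH) (use Exists.prems in \<open>simp only: free_for.simps\<close>)
    also have "\<dots> = gr_sat I ((subst_seq I m s)(x := d)) \<phi>"
    proof (rule gr_sat_cong)
      fix z assume z: "z \<in> free_vars \<phi>"
      show "subst_seq I (m(x := None)) (s(x := d)) z = ((subst_seq I m s)(x := d)) z"
      proof (cases "z = x \<or> m z = None")
        case True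
        then show ?thesis by (auto simp: subst_seq_def)
      next
        case False
        then obtain t where "z \<noteq> x" and t: "m z = Some t" by auto
        then have "x \<notin> tm_vars t" using Exists.prems z by auto
        then have "tm_val I (s(x := d)) t = tm_val I s t"
          by (intro tm_val_cong) auto
        then show ?thesis using \<open>z \<noteq> x\<close> t by (simp add: subst_seq_def)
      qed
    qed
    finally show ?thesis .
  qed
  then show ?case by simp
qed auto

lemma gr_sat_subst_var:
  assumes "free_for [y \<mapsto> Var x] \<phi>"
  shows "gr_sat I s (subst [y \<mapsto> Var x] \<phi>) = gr_sat I (s(y := s x)) \<phi>"
proof -
  have "subst_seq I [y \<mapsto> Var x] s = s(y := s x)"
    by (auto simp: subst_seq_def)
  then show ?thesis using gr_sat_subst[OF assms] by metis
qed

text \<open>The semantic content of both quantifier laws: \<open>s x\<close> is a witness for \<open>\<exists>y\<close>.\<close>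

lemma gr_sat_subst_var_le_Exists:
  assumes "is_interp I" "s \<in> seqs I" "free_for [y \<mapsto> Var x] \<phi>"
  shows "gr_sat I s (subst [y \<mapsto> Var x] \<phi>) \<le> gr_sat I s (Exists y \<phi>)"
proof -
  have "s x \<in> dom_of I" using assms(2) by (simp add: seqs_def)
  then show ?thesis
    unfolding gr_sat_subst_var[OF assms(3)] by (rule gr_sat_le_Exists[OF assms(1,2)])
qed

text \<open>
  The frame law once more, for the family indexed by the domain; as \<open>y\<close> is not free in \<open>\<phi>\<close>,
  the grade of \<open>\<phi>\<close> is a constant of this family.
\<close>

lemma gr_And_Exists:
  assumes "is_interp I" "y \<notin> free_vars \<phi>"
  shows "gr I (And \<phi> (Exists y \<psi>)) (Exists y (And \<phi> \<psi>)) = 1"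
  unfolding gr_eq_1_iff[OF assms(1)]
proof
  fix s assume s: "s \<in> seqs I"
  have "min (gr_sat I s \<phi>) (gr_sat I (s(y := d)) \<psi>) \<le> gr_sat I s (Exists y (And \<phi> \<psi>))"
    if d: "d \<in> dom_of I" for d
  proof -
    have "gr_sat I (s(y := d)) \<phi> = gr_sat I s \<phi>"
      using assms(2) by (intro gr_sat_cong) auto
    then show ?thesis
      using gr_sat_le_Exists[OF assms(1) s d, of y "And \<phi> \<psi>"] by simp
  qed
  moreover have "0 \<le> gr_sat I s (Exists y (And \<phi> \<psi>))"
    using gr_sat_in_01[OF assms(1) s, of "Exists y (And \<phi> \<psi>)"] by simp
  ultimately show "gr_sat I s (And \<phi> (Exists y \<psi>)) \<le> gr_sat I s (Exists y (And \<phi> \<psi>))"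
    by (simp add: min_Exists_le_iff[OF assms(1) s] del: gr_sat.simps(7))
qed

section \<open>Equality of tuples\<close>

text \<open>
  A one-element list is its own conjunction, without a final \<open>Truth\<close>; the bound by 1 makes this
  agree with the recursion for longer lists.
\<close>

lemma gr_sat_conj_list_Cons:
  "gr_sat I s \<phi> \<le> 1
    \<Longrightarrow> gr_sat I s (conj_list (\<phi> # \<phi>s)) = min (gr_sat I s \<phi>) (gr_sat I s (conj_list \<phi>s))"
  by (cases \<phi>s) auto

lemma gr_sat_tuple_eq:
  assumes "length xs = length ys"
  shows "gr_sat I s (tuple_eq xs ys) = (if map s xs = map s ys then 1 else 0)"
  using assms
proof (induction xs ys rule: list_induct2)
  case Nil
  then show ?case by (simp add: tuple_eq_def)
next
  case (Cons x xs y ys)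
  then show ?case by (simp add: tuple_eq_def gr_sat_conj_list_Cons)
qed

lemma subst_seq_tuple:
  assumes "length xs = length ys" "map s xs = map s ys"
  shows "subst_seq I (map_of (zip xs (map Var ys))) s = s"
proof
  show "subst_seq I (map_of (zip xs (map Var ys))) s z = s z" for z
    using assms by (induction xs ys rule: list_induct2) (auto simp: subst_seq_def)
qed

text \<open>Equations take only the grades 0 and 1, so at each \<open>s\<close> they either hold or refute the premise.\<close>

lemma gr_tuple_eq_subst:
  fixes \<phi> :: "'i fm"
  assumes "is_interp I" "length xs = length ys"
    and "free_for (map_of (zip xs (map Var ys))) \<phi>" (is "free_for ?m \<phi>")
  shows "gr I (And (tuple_eq xs ys) \<phi>) (subst ?m \<phi>) = 1"
  unfolding gr_eq_1_iff[OF assms(1)]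
proof
  fix s assume s: "s \<in> seqs I"
  show "gr_sat I s (And (tuple_eq xs ys) \<phi>) \<le> gr_sat I s (subst ?m \<phi>)"
  proof (cases "map s xs = map s ys")
    case True
    then have "gr_sat I s (subst ?m \<phi>) = gr_sat I s \<phi>"
      by (simp add: gr_sat_subst[OF assms(3)] subst_seq_tuple[OF assms(2)])
    then show ?thesis by simp
  next
    case False
    then have "gr_sat I s (tuple_eq xs ys :: 'i fm) = 0"
      by (simp add: gr_sat_tuple_eq[OF assms(2)])
    then show ?thesis using gr_sat_in_01[OF assms(1) s, of "subst ?m \<phi>"]
      by (simp add: min_le_iff_disj)
  qed
qed

section \<open>The laws of graded sequents\<close>

theorem theorem6p5p1:
  fixes I :: "'d interp"
    and \<phi> \<psi> \<chi> :: "'i fm"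
    and S :: "'i fm set"
    and x y :: nat
    and xs ys :: "nat list"
  assumes "is_interp I"
  shows
    "gr I \<phi> \<phi> = 1
   \<and> min (gr I \<phi> \<psi>) (gr I \<psi> \<chi>) \<le> gr I \<phi> \<chi>
   \<and> (gr I \<phi> Truth = 1
      \<and> gr I (And \<phi> \<psi>) \<phi> = 1
      \<and> gr I (And \<phi> \<psi>) \<psi> = 1
      \<and> min (gr I \<phi> \<psi>) (gr I \<phi> \<chi>) = gr I \<phi> (And \<psi> \<chi>))
   \<and> (\<forall>J F. F ` J = S \<longrightarrow>
        (\<phi> \<in> S \<longrightarrow> gr I \<phi> (Disj J F) = 1)
      \<and> Inf01 ((\<lambda>\<theta>. gr I \<theta> \<psi>) ` S) \<le> gr I (Disj J F) \<psi>)
   \<and> (\<forall>J F K G. F ` J = S \<longrightarrow> G ` K = {And \<phi> \<theta> | \<theta>. \<theta> \<in> S} \<longrightarrow>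
        gr I (And \<phi> (Disj J F)) (Disj K G) = 1)
   \<and> gr I (Truth :: 'i fm) (Eq (Var x) (Var x)) = 1
   \<and> (length xs = length ys \<longrightarrow> free_for (map_of (zip xs (map Var ys))) \<phi> \<longrightarrow>
        gr I (And (tuple_eq xs ys) \<phi>) (subst (map_of (zip xs (map Var ys))) \<phi>) = 1)
   \<and> ((free_for [y \<mapsto> Var x] \<psi> \<longrightarrow>
          gr I \<phi> (subst [y \<mapsto> Var x] \<psi>) \<le> gr I \<phi> (Exists y \<psi>))
      \<and> (free_for [y \<mapsto> Var x] \<phi> \<longrightarrow>
          gr I (Exists y \<phi>) \<psi> \<le> gr I (subst [y \<mapsto> Var x] \<phi>) \<psi>))
   \<and> (y \<notin> free_vars \<phi> \<longrightarrow>
        gr I (And \<phi> (Exists y \<psi>)) (Exists y (And \<phi> \<psi>)) = 1)"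
proof (intro conjI allI impI)
  note I = \<open>is_interp I\<close>
  show "gr I \<phi> \<phi> = 1" by (simp add: gr_eq_1_iff[OF I])
  show "min (gr I \<phi> \<psi>) (gr I \<psi> \<chi>) \<le> gr I \<phi> \<chi>" by (rule gr_trans[OF I])
  show "gr I \<phi> Truth = 1"
    using gr_sat_in_01[OF I, of _ \<phi>] by (simp add: gr_eq_1_iff[OF I])
  show "gr I (And \<phi> \<psi>) \<phi> = 1" "gr I (And \<phi> \<psi>) \<psi> = 1"
    by (simp_all add: gr_eq_1_iff[OF I])
  show "min (gr I \<phi> \<psi>) (gr I \<phi> \<chi>) = gr I \<phi> (And \<psi> \<chi>)"
    by (rule gr_And_right[OF I, symmetric])
  show "gr I (Truth :: 'i fm) (Eq (Var x) (Var x)) = 1"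
    by (simp add: gr_eq_1_iff[OF I])
next
  fix J :: "'i set" and F assume F: "F ` J = S" and "\<phi> \<in> S"
  then obtain i where "i \<in> J" "F i = \<phi>" by blast
  then show "gr I \<phi> (Disj J F) = 1"
    using gr_sat_le_Disj[OF assms, of _ i J F] by (simp add: gr_eq_1_iff[OF assms])
next
  fix J :: "'i set" and F assume "F ` J = S"
  then show "Inf01 ((\<lambda>\<theta>. gr I \<theta> \<psi>) ` S) \<le> gr I (Disj J F) \<psi>"
    using Inf_gr_le_gr_Disj[OF assms, of \<psi> F J] by simp
next
  fix J K :: "'i set" and F G assume "F ` J = S" and "G ` K = {And \<phi> \<theta> | \<theta>. \<theta> \<in> S}"
  then show "gr I (And \<phi> (Disj J F)) (Disj K G) = 1"
    by (intro gr_And_Disj[OF assms]) simp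
next
  assume "length xs = length ys" "free_for (map_of (zip xs (map Var ys))) \<phi>"
  then show "gr I (And (tuple_eq xs ys) \<phi>) (subst (map_of (zip xs (map Var ys))) \<phi>) = 1"
    by (rule gr_tuple_eq_subst[OF assms])
next
  assume "free_for [y \<mapsto> Var x] \<psi>"
  then show "gr I \<phi> (subst [y \<mapsto> Var x] \<psi>) \<le> gr I \<phi> (Exists y \<psi>)"
    by (intro gr_mono[OF assms] gr_sat_subst_var_le_Exists[OF assms] order.refl)
next
  assume "free_for [y \<mapsto> Var x] \<phi>"
  then show "gr I (Exists y \<phi>) \<psi> \<le> gr I (subst [y \<mapsto> Var x] \<phi>) \<psi>"
    by (intro gr_mono[OF assms] gr_sat_subst_var_le_Exists[OF assms] order.refl)
next
  assume "y \<notin> free_vars \<phi>"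
  then show "gr I (And \<phi> (Exists y \<psi>)) (Exists y (And \<phi> \<psi>)) = 1"
    by (rule gr_And_Exists[OF assms])
qed

end
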